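(* Let $n\ge1$. Parametrize the $n$-dimensional multivariate normal distributions by $(U,\boldsymbol\mu)$, where $U\in\mathbb{R}^{n\times n}$ is the upper triangular Cholesky factor (with positive diagonal) of the covariance matrix $UU^T$ and $\boldsymbol\mu\in\mathbb{R}^n$ is the mean, and let $\Theta$ be the set of all such pairs. Then the group $G_{\mathcal N}$, with the group action $\alpha_\Theta$ on $\Theta$ given by $(V,\mathbf{m})\cdot(U,\boldsymbol\mu)=(VU,V\boldsymbol\mu+\mathbf{m})$ and the group action $\alpha_{\mathcal Y}$ on the observation space $\mathcal{Y}=\mathbb{R}^n$ given by $(V,\mathbf{m})\cdot\mathbf{y}=V\mathbf{y}+\mathbf{m}$, provides the multivariate normal likelihood $p(\cdot\mid(U,\boldsymbol\mu))=\mathcal{N}(\boldsymbol\mu,UU^T)$ with a locally compact topological group structure.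
   Context: $G_{\mathcal N}$ is the group of pairs $(V,\mathbf{m})$ with $V\in\mathbb{R}^{n\times n}$ upper triangular with positive diagonal and $\mathbf{m}\in\mathbb{R}^n$, with operation $(V_2,\mathbf{m}_2)\cdot(V_1,\mathbf{m}_1)=(V_2V_1,V_2\mathbf{m}_1+\mathbf{m}_2)$ (with its natural topology as a subset of Euclidean space). A likelihood $p(\cdot\mid\theta)$, $\theta\in\Theta$, on a standard Borel space $\mathcal{Y}$ has a locally compact topological group structure, provided by $G$, if $G$ is a locally compact topological group acting on $\mathcal{Y}$ and on $\Theta$ by measurable actions $\alpha_{\mathcal Y}:G\times\mathcal{Y}\to\mathcal{Y}$ and $\alpha_\Theta:G\times\Theta\to\Theta$ such that $p(A\mid\theta)=p(gA\mid g\theta)$ for all $g\in G$, $\theta\in\Theta$ and all Borel sets $A\subseteq\mathcal{Y}$. *)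

theory Defs
  imports "HOL-Probability.Probability" "HOL-Algebra.Group_Action"
begin

section \<open>Likelihoods with a locally compact topological group structure\<close>

definition borel_of :: "'a topology \<Rightarrow> 'a measure" where
  "borel_of T = sigma (topspace T) {U. openin T U}"

definition standard_borel :: "'a measure \<Rightarrow> bool" where
  "standard_borel M \<longleftrightarrow>
     (\<exists>T. completely_metrizable_space T \<and> second_countable T \<and>
          space M = topspace T \<and> sets M = sets (borel_of T))"

locale topological_group = Group.group G for G :: "('g, 'm) monoid_scheme" (structure) +
  fixes T :: "'g topology"
  assumes topspace_eq_carrier: "topspace T = carrier G"
    and continuous_mult: "continuous_map (prod_topology T T) T (\<lambda>(x, y). x \<otimes> y)"
    and continuous_inv: "continuous_map T T (\<lambda>x. inv x)"

text \<open>Locally compact groups are Hausdorff by convention.\<close>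

locale locally_compact_group = topological_group +
  assumes locally_compact: "locally_compact_space T"
    and Hausdorff: "Hausdorff_space T"

text \<open>
  The action is given as a function of both arguments that is meaningful only on the carriers;
  \<^const>\<open>group_action\<close> expects extensional functions, hence the \<^const>\<open>restrict\<close>.
  The measure on \<open>X\<close> is irrelevant, only its \<open>\<sigma>\<close>-algebra is used.
\<close>

locale measurable_group_action = topological_group G T + group_action G "space X"
    "\<lambda>g. restrict (\<alpha> g) (space X)"
  for G :: "('g, 'm) monoid_scheme" (structure) and T and X :: "'x measure"
    and \<alpha> :: "'g \<Rightarrow> 'x \<Rightarrow> 'x" +
  assumes measurable_action: "(\<lambda>(g, x). \<alpha> g x) \<in> borel_of T \<Otimes>\<^sub>M X \<rightarrow>\<^sub>M X"

text \<open>
  \<open>Y\<close> is the observation space and \<open>\<Theta>\<close> the parameter space, both as measurable spaces;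
  \<open>p \<theta>\<close> is the distribution \<open>p(\<cdot> | \<theta>)\<close> on \<open>Y\<close>.
\<close>

locale locally_compact_group_likelihood =
  locally_compact_group G T +
  Y: measurable_group_action G T Y \<alpha>\<^sub>Y +
  \<Theta>: measurable_group_action G T \<Theta> \<alpha>\<^sub>\<Theta>
  for G :: "('g, 'm) monoid_scheme" (structure) and T
    and Y :: "'y measure" and \<Theta> :: "'t measure"
    and p :: "'t \<Rightarrow> 'y measure"
    and \<alpha>\<^sub>Y :: "'g \<Rightarrow> 'y \<Rightarrow> 'y" and \<alpha>\<^sub>\<Theta> :: "'g \<Rightarrow> 't \<Rightarrow> 't" +
  assumes standard_borel: "standard_borel Y"
    and prob_space: "\<theta> \<in> space \<Theta> \<Longrightarrow> prob_space (p \<theta>)"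
    and sets_eq: "\<theta> \<in> space \<Theta> \<Longrightarrow> sets (p \<theta>) = sets Y"
    and invariant: "\<lbrakk>g \<in> carrier G; \<theta> \<in> space \<Theta>; A \<in> sets Y\<rbrakk>
      \<Longrightarrow> emeasure (p \<theta>) A = emeasure (p (\<alpha>\<^sub>\<Theta> g \<theta>)) (\<alpha>\<^sub>Y g ` A)"

section \<open>The multivariate normal likelihood\<close>

definition mvn_density :: "real ^ 'n \<Rightarrow> real ^ 'n ^ 'n \<Rightarrow> real ^ 'n \<Rightarrow> real" where
  "mvn_density \<mu> \<Sigma> x =
     exp (- ((x - \<mu>) \<bullet> (matrix_inv \<Sigma> *v (x - \<mu>))) / 2) / sqrt ((2 * pi) ^ CARD('n) * det \<Sigma>)"

text \<open>The normal distribution with mean \<open>\<mu>\<close> and positive definite covariance matrix \<open>\<Sigma>\<close>.\<close>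

definition multivariate_normal :: "real ^ 'n \<Rightarrow> real ^ 'n ^ 'n \<Rightarrow> (real ^ 'n) measure" where
  "multivariate_normal \<mu> \<Sigma> = density lborel (\<lambda>x. ennreal (mvn_density \<mu> \<Sigma> x))"

type_synonym 'n matrix_vector = "(real ^ 'n ^ 'n) \<times> (real ^ 'n)"

definition upper_triangular_pos :: "real ^ 'n::{finite,wellorder} ^ 'n::{finite,wellorder} \<Rightarrow> bool" where
  "upper_triangular_pos U \<longleftrightarrow> (\<forall>i j. j < i \<longrightarrow> U $ i $ j = 0) \<and> (\<forall>i. 0 < U $ i $ i)"

definition G_normal :: "'n::{finite,wellorder} matrix_vector monoid" where
  "G_normal = \<lparr>carrier = {(V, m). upper_triangular_pos V},
     mult = (\<lambda>(V2, m2) (V1, m1). (V2 ** V1, V2 *v m1 + m2)),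
     one = (mat 1, 0)\<rparr>"

definition top_normal :: "'n::{finite,wellorder} matrix_vector topology" where
  "top_normal = top_of_set (carrier G_normal)"

definition \<Theta>_normal :: "'n::{finite,wellorder} matrix_vector measure" where
  "\<Theta>_normal = restrict_space borel {(U, \<mu>). upper_triangular_pos U}"

definition normal_likelihood ::
    "'n::{finite,wellorder} matrix_vector \<Rightarrow> (real ^ 'n::{finite,wellorder}) measure" where
  "normal_likelihood = (\<lambda>(U, \<mu>). multivariate_normal \<mu> (U ** transpose U))"

definition \<alpha>_param ::
    "'n::{finite,wellorder} matrix_vector \<Rightarrow> 'n::{finite,wellorder} matrix_vector
      \<Rightarrow> 'n::{finite,wellorder} matrix_vector" where
  "\<alpha>_param = (\<lambda>(V, m) (U, \<mu>). (V ** U, V *v \<mu> + m))"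

definition \<alpha>_obs ::
    "'n::{finite,wellorder} matrix_vector
      \<Rightarrow> real ^ 'n::{finite,wellorder} \<Rightarrow> real ^ 'n::{finite,wellorder}" where
  "\<alpha>_obs = (\<lambda>(V, m) y. V *v y + m)"

end

theory Submission
  imports Defs
begin

text \<open>
  A pair \<open>(V, m)\<close> is the affine map \<open>y \<mapsto> V y + m\<close>, the group operation is composition, and the
  parameter \<open>(U, \<mu>)\<close> is the affine map that carries the standard normal distribution to
  \<open>N(\<mu>, U U\<^sup>T)\<close>. Acting on a parameter is therefore multiplication in the group, and acting on
  observations is application of the map. Invariance of the likelihood says that pushing
  \<open>N(\<mu>, \<Sigma>)\<close> forward along \<open>y \<mapsto> V y + m\<close> gives \<open>N(V \<mu> + m, V \<Sigma> V\<^sup>T)\<close>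
  (\<open>distr_multivariate_normal_affine\<close>). This is the change of variables formula
  \<open>lborel_affine_matrix\<close> together with the transformation of the density,
  \<open>mvn_density_affine\<close>. The same formula reduces the total mass of every normal
  distribution to that of the standard one, whose density is a product of one-dimensional
  standard normal densities.

  On the side of the group, upper triangular matrices with positive diagonal are closed under products and
  inverses; products are polynomial in the entries and inverses rational by Cramer's rule, so both
  are continuous. The carrier is the intersection of a closed and an open subset of a Euclidean
  space and thus locally compact. Both actions are restrictions of polynomial maps, hence Borel
  measurable.
\<close>

section \<open>Inverse matrices\<close>

lemma
  fixes A :: "'a::field ^ 'n ^ 'n"
  assumes "invertible A"
  shows matrix_inv_right_cancel: "A ** matrix_inv A = mat 1"
    and matrix_inv_left_cancel: "matrix_inv A ** A = mat 1"
proof -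
  have "\<exists>B. A ** B = mat 1 \<and> B ** A = mat 1"
    using assms by (auto simp: invertible_def)
  from someI_ex[OF this] show "A ** matrix_inv A = mat 1" "matrix_inv A ** A = mat 1"
    by (auto simp: matrix_inv_def)
qed

lemma matrix_inv_eqI:
  fixes A B :: "'a::field ^ 'n ^ 'n"
  assumes "B ** A = mat 1"
  shows "matrix_inv A = B"
proof -
  have "invertible A"
    using assms invertible_left_inverse by blast
  then have "B ** (A ** matrix_inv A) = B"
    by (simp add: matrix_inv_right_cancel)
  then show ?thesis
    using assms by (simp add: matrix_mul_assoc)
qed

text \<open>By Cramer's rule the entries of the inverse are quotients of polynomials in the entries of
  the matrix.\<close>

lemma matrix_inv_cramer:
  fixes A :: "real ^ 'n ^ 'n"
  assumes "invertible A"
  shows "matrix_inv A = (\<chi> k l. det (\<chi> i j. if j = k then axis l 1 $ i else A $ i $ j) / det A)"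
proof -
  have "A *v column l (matrix_inv A) = axis l 1" for l
  proof -
    have "A *v column l (matrix_inv A) = A *v (matrix_inv A *v axis l 1)"
      by (simp add: matrix_vector_mul_component matrix_vector_mult_basis)
    also have "\<dots> = axis l 1"
      using assms by (simp add: matrix_vector_mul_assoc matrix_inv_right_cancel)
    finally show ?thesis .
  qed
  moreover have "det A \<noteq> 0"
    using assms by (simp add: invertible_det_nz)
  ultimately have "column l (matrix_inv A)
      = (\<chi> k. det (\<chi> i j. if j = k then axis l 1 $ i else A $ i $ j) / det A)" for l
    by (simp add: cramer)
  then show ?thesis
    by (simp add: column_def vec_eq_iff)
qed

lemma continuous_on_det [continuous_intros]:
  fixes f :: "'a::topological_space \<Rightarrow> real ^ 'n ^ 'n"
  assumes "\<And>i j. continuous_on S (\<lambda>x. f x $ i $ j)"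
  shows "continuous_on S (\<lambda>x. det (f x))"
  unfolding det_def by (intro continuous_intros assms)

lemma continuous_on_matrix_inv:
  "continuous_on {A :: real ^ 'n ^ 'n. invertible A} matrix_inv"
proof -
  have "continuous_on {A :: real ^ 'n ^ 'n. invertible A}
      (\<lambda>A. \<chi> k l. det (\<chi> i j. if j = k then axis l 1 $ i else A $ i $ j) / det A)"
  proof (intro continuous_on_vec_lambda continuous_on_divide continuous_on_det)
    fix k l i j :: 'n
    show "continuous_on {A :: real ^ 'n ^ 'n. invertible A}
        (\<lambda>A. (\<chi> i j. if j = k then axis l 1 $ i else A $ i $ j) $ i $ j)"
      by (cases "j = k") (auto intro!: continuous_intros)
  qed (auto intro!: continuous_intros simp: invertible_det_nz)
  then show ?thesis
    by (rule continuous_on_eq) (simp add: matrix_inv_cramer)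
qed

lemma continuous_on_matrix_mult [continuous_intros]:
  fixes f :: "'a::topological_space \<Rightarrow> real ^ 'm ^ 'n" and g :: "'a \<Rightarrow> real ^ 'k ^ 'm"
  assumes "continuous_on S f" "continuous_on S g"
  shows "continuous_on S (\<lambda>x. f x ** g x)"
  unfolding matrix_matrix_mult_def by (intro continuous_intros assms)

lemma continuous_on_matrix_vector_mult [continuous_intros]:
  fixes f :: "'a::topological_space \<Rightarrow> real ^ 'm ^ 'n" and g :: "'a \<Rightarrow> real ^ 'm"
  assumes "continuous_on S f" "continuous_on S g"
  shows "continuous_on S (\<lambda>x. f x *v g x)"
  unfolding matrix_vector_mult_def by (intro continuous_intros assms)

section \<open>Upper triangular matrices with positive diagonal\<close>

lemma upper_triangular_pos_mat_1: "upper_triangular_pos (mat 1)"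
  by (auto simp: upper_triangular_pos_def mat_def)

lemma upper_triangular_pos_det_pos:
  assumes "upper_triangular_pos U"
  shows "0 < det U"
  using assms by (subst det_upperdiagonal) (auto simp: upper_triangular_pos_def intro!: prod_pos)

lemma upper_triangular_pos_invertible: "upper_triangular_pos U \<Longrightarrow> invertible U"
  using upper_triangular_pos_det_pos[of U] by (simp add: invertible_det_nz)

lemma upper_triangular_pos_mult:
  fixes U V :: "real ^ 'n::{finite,wellorder} ^ 'n::{finite,wellorder}"
  assumes "upper_triangular_pos U" "upper_triangular_pos V"
  shows "upper_triangular_pos (U ** V)"
  unfolding upper_triangular_pos_def
proof (intro conjI allI impI)
  fix i j :: 'n assume "j < i"
  then have "U $ i $ k * V $ k $ j = 0" for k
    using assms by (cases "k < i") (auto simp: upper_triangular_pos_def)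
  then have "(\<Sum>k\<in>UNIV. U $ i $ k * V $ k $ j) = 0"
    by (intro sum.neutral) blast
  then show "(U ** V) $ i $ j = 0"
    by (simp add: matrix_matrix_mult_def)
next
  fix i :: 'n
  have "U $ i $ k * V $ k $ i = 0" if "k \<noteq> i" for k
    using assms that by (cases "k < i") (auto simp: upper_triangular_pos_def)
  then have "(\<Sum>k\<in>UNIV - {i}. U $ i $ k * V $ k $ i) = 0"
    by (intro sum.neutral) blast
  then have "(U ** V) $ i $ i = U $ i $ i * V $ i $ i"
    by (simp add: matrix_matrix_mult_def sum.remove[of UNIV i])
  then show "0 < (U ** V) $ i $ i"
    using assms by (simp add: upper_triangular_pos_def)
qed

text \<open>Let \<open>B\<close> be the inverse of \<open>U\<close>. If \<open>i\<close> is the last row in which column \<open>j\<close> of \<open>B\<close> does not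
  vanish, then \<open>(U ** B) $ i $ j\<close> reduces to the single product \<open>U $ i $ i * B $ i $ j \<noteq> 0\<close>,
  so \<open>i = j\<close> because \<open>U ** B\<close> is the identity.\<close>

lemma upper_triangular_pos_matrix_inv:
  fixes U :: "real ^ 'n::{finite,wellorder} ^ 'n::{finite,wellorder}"
  assumes U: "upper_triangular_pos U"
  shows "upper_triangular_pos (matrix_inv U)"
proof -
  define B where "B = matrix_inv U"
  have UB: "(U ** B) $ i $ j = (if i = j then 1 else 0)" for i j
    using matrix_inv_right_cancel[OF upper_triangular_pos_invertible[OF U]]
    by (simp add: B_def mat_def)
  have prod: "(U ** B) $ i $ j = U $ i $ i * B $ i $ j" if "\<And>k. i < k \<Longrightarrow> B $ k $ j = 0" for i j
  proof -
    have "U $ i $ k * B $ k $ j = 0" if "k \<noteq> i" for k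
      using U that \<open>\<And>k. i < k \<Longrightarrow> B $ k $ j = 0\<close>
      by (cases "k < i") (auto simp: upper_triangular_pos_def)
    then have "(\<Sum>k\<in>UNIV - {i}. U $ i $ k * B $ k $ j) = 0"
      by (intro sum.neutral) blast
    then show ?thesis
      by (simp add: matrix_matrix_mult_def sum.remove[of UNIV i])
  qed
  have upper: "B $ i $ j = 0" if "j < i" for i j
  proof (rule ccontr)
    let ?S = "{i. B $ i $ j \<noteq> 0}"
    assume "B $ i $ j \<noteq> 0"
    then have "i \<in> ?S" by simp
    then have "Max ?S \<in> ?S" and "i \<le> Max ?S"
      using Max_in[of ?S] Max_ge[of ?S i] finite[of ?S] by blast+
    moreover have "B $ k $ j = 0" if "Max ?S < k" for k
      using that Max_ge[OF finite, of k ?S] by (metis (mono_tags, lifting) leD mem_Collect_eq)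
    then have "(U ** B) $ Max ?S $ j = U $ Max ?S $ Max ?S * B $ Max ?S $ j"
      by (rule prod)
    moreover have "U $ Max ?S $ Max ?S \<noteq> 0"
      using U by (metis less_irrefl upper_triangular_pos_def)
    moreover have "Max ?S \<noteq> j"
      using \<open>j < i\<close> \<open>i \<le> Max ?S\<close> by (metis leD)
    ultimately show False
      using UB[of "Max ?S" j] by simp
  qed
  have "0 < B $ i $ i" for i
  proof -
    have "U $ i $ i * B $ i $ i = 1"
      using prod[of i i] upper UB by simp
    moreover have "0 < U $ i $ i"
      using U by (simp add: upper_triangular_pos_def)
    ultimately show ?thesis
      by (metis zero_less_mult_pos zero_less_one)
  qed
  with upper show ?thesis
    by (auto simp: upper_triangular_pos_def B_def)
qed

section \<open>The affine group as a locally compact topological group\<close>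

lemma mem_carrier_G_normal [simp]: "(V, m) \<in> carrier G_normal \<longleftrightarrow> upper_triangular_pos V"
  by (simp add: G_normal_def)

lemma mult_G_normal [simp]: "(V2, m2) \<otimes>\<^bsub>G_normal\<^esub> (V1, m1) = (V2 ** V1, V2 *v m1 + m2)"
  by (simp add: G_normal_def)

lemma one_G_normal [simp]: "\<one>\<^bsub>G_normal\<^esub> = (mat 1, 0)"
  by (simp add: G_normal_def)

lemma group_G_normal: "group (G_normal :: 'n::{finite,wellorder} matrix_vector monoid)"
proof (rule groupI)
  fix x y z :: "'n matrix_vector"
  show "x \<otimes>\<^bsub>G_normal\<^esub> y \<otimes>\<^bsub>G_normal\<^esub> z = x \<otimes>\<^bsub>G_normal\<^esub> (y \<otimes>\<^bsub>G_normal\<^esub> z)"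
    by (cases x; cases y; cases z)
      (simp add: matrix_mul_assoc matrix_vector_mul_assoc matrix_vector_right_distrib)
next
  fix x :: "'n matrix_vector"
  assume "x \<in> carrier G_normal"
  then obtain V m where x: "x = (V, m)" "upper_triangular_pos V"
    by (cases x) auto
  show "\<exists>y\<in>carrier G_normal. y \<otimes>\<^bsub>G_normal\<^esub> x = \<one>\<^bsub>G_normal\<^esub>"
    by (rule bexI[of _ "(matrix_inv V, - (matrix_inv V *v m))"])
      (simp_all add: x upper_triangular_pos_matrix_inv matrix_inv_left_cancel
        upper_triangular_pos_invertible)
qed (auto simp: upper_triangular_pos_mult upper_triangular_pos_mat_1)

lemma inv_G_normal:
  assumes "upper_triangular_pos V"
  shows "inv\<^bsub>G_normal\<^esub> (V, m) = (matrix_inv V, - (matrix_inv V *v m))"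
  using assms
  by (intro group.inv_equality[OF group_G_normal])
    (simp_all add: upper_triangular_pos_matrix_inv matrix_inv_left_cancel
      upper_triangular_pos_invertible)

lemma topological_group_G_normal:
  "topological_group (G_normal :: 'n::{finite,wellorder} matrix_vector monoid) top_normal"
proof -
  let ?C = "carrier (G_normal :: 'n matrix_vector monoid)"
  interpret group "G_normal :: 'n matrix_vector monoid"
    by (rule group_G_normal)
  have "continuous_on (?C \<times> ?C) (\<lambda>(x, y). x \<otimes>\<^bsub>G_normal\<^esub> y)"
    unfolding G_normal_def case_prod_beta by (simp, intro continuous_intros)
  moreover have "(\<lambda>(x, y). x \<otimes>\<^bsub>G_normal\<^esub> y) \<in> ?C \<times> ?C \<rightarrow> ?C"
    by auto
  moreover have "continuous_on ?C (\<lambda>x. inv\<^bsub>G_normal\<^esub> x)"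
  proof -
    have *: "continuous_on ?C (\<lambda>x. matrix_inv (fst x))"
      by (rule continuous_on_compose2[OF continuous_on_matrix_inv])
        (auto intro!: continuous_intros upper_triangular_pos_invertible)
    have "continuous_on ?C (\<lambda>x. (matrix_inv (fst x), - (matrix_inv (fst x) *v snd x)))"
      by (intro continuous_intros *)
    then show ?thesis
      by (rule continuous_on_eq) (auto simp: inv_G_normal)
  qed
  moreover have "(\<lambda>x. inv\<^bsub>G_normal\<^esub> x) \<in> ?C \<rightarrow> ?C"
    by auto
  ultimately show ?thesis
    unfolding top_normal_def
    by unfold_locales
      (simp_all add: prod_topology_subtopology_eu continuous_map_in_subtopology
        flip: image_subset_iff_funcset)
qed

text \<open>The carrier is locally closed: the vanishing of the entries below the diagonal is a closed
  condition, and the positivity of the diagonal is an open one.\<close>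

lemma locally_compact_group_G_normal:
  "locally_compact_group (G_normal :: 'n::{finite,wellorder} matrix_vector monoid) top_normal"
proof -
  interpret topological_group "G_normal :: 'n matrix_vector monoid" top_normal
    by (rule topological_group_G_normal)
  define C where "C = {x :: 'n matrix_vector. \<forall>i j. j < i \<longrightarrow> fst x $ i $ j = 0}"
  define D where "D = {x :: 'n matrix_vector. \<forall>i. 0 < fst x $ i $ i}"
  have "closed C"
    unfolding C_def by (intro closed_Collect_all closed_Collect_imp closed_Collect_eq
      open_Collect_const continuous_intros)
  moreover have "open D"
  proof -
    have "D = (\<Inter>i. {x. 0 < fst x $ i $ i})"
      by (auto simp: D_def)
    then show ?thesis
      by (auto intro!: open_INT open_Collect_less continuous_intros)
  qed
  ultimately have "locally_compact_space (subtopology (subtopology euclidean D) (D \<inter> C))"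
    by (intro locally_compact_space_closed_subset locally_compact_space_open_subset
      locally_compact_space_euclidean) (auto simp: Hausdorff_space_euclidean closedin_closed_Int)
  moreover have "carrier G_normal = D \<inter> C"
    by (auto simp: C_def D_def G_normal_def upper_triangular_pos_def)
  ultimately have "locally_compact_space (top_normal :: 'n matrix_vector topology)"
    by (simp add: top_normal_def subtopology_subtopology)
  then show ?thesis
    by unfold_locales (simp_all add: top_normal_def Hausdorff_space_subtopology
      Hausdorff_space_euclidean)
qed

section \<open>Measurable actions\<close>

lemma standard_borel_borel:
  "standard_borel (borel :: 'a::{complete_space,second_countable_topology} measure)"
proof -
  obtain B :: "'a set set" where "countable B" "topological_basis B"
    using ex_countable_basis by blast
  have "second_countable (euclidean :: 'a topology)"
    unfolding second_countable_def
  proof (intro exI[of _ B] conjI ballI allI impI)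
    show "openin euclidean V" if "V \<in> B" for V
      using topological_basis_open[OF \<open>topological_basis B\<close> that] by simp
    show "\<exists>V\<in>B. x \<in> V \<and> V \<subseteq> U" if "openin euclidean U \<and> x \<in> U" for U x
      using that topological_basisE[OF \<open>topological_basis B\<close>, of U x] by (metis open_openin)
  qed fact
  then show ?thesis
    unfolding standard_borel_def borel_of_def
    by (intro exI[of _ euclidean]) (simp add: completely_metrizable_space_euclidean borel_def)
qed

lemma space_borel_of: "space (borel_of T) = topspace T"
  unfolding borel_of_def by (rule space_measure_of) (auto dest: openin_subset)

lemma openin_imp_sets_borel_of: "openin T U \<Longrightarrow> U \<in> sets (borel_of T)"
  unfolding borel_of_def by (subst sets_measure_of) (auto dest: openin_subset)

lemma measurable_borel_of_subtopology:
  "(\<lambda>x. x) \<in> borel_of (top_of_set S) \<rightarrow>\<^sub>M borel"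
proof (rule borel_measurableI)
  fix U :: "'a set" assume "open U"
  then have "openin (top_of_set S) (S \<inter> U)"
    by blast
  then have "S \<inter> U \<in> sets (borel_of (top_of_set S))"
    by (rule openin_imp_sets_borel_of)
  then show "(\<lambda>x. x) -` U \<inter> space (borel_of (top_of_set S)) \<in> sets (borel_of (top_of_set S))"
    by (simp add: space_borel_of Int_commute)
qed

text \<open>The topology of the group enters only through the continuous inclusion into the ambient
  space, so an action that extends to a continuous map on that space is measurable.\<close>

lemma measurable_continuous_action:
  fixes f :: "'a::second_countable_topology \<times> 'b::second_countable_topology \<Rightarrow> 'c::topological_space"
  assumes "continuous_on UNIV f"
  shows "f \<in> borel_of (top_of_set S) \<Otimes>\<^sub>M borel \<rightarrow>\<^sub>M borel"
proof -
  have "(\<lambda>x. (fst x, snd x)) \<in> borel_of (top_of_set S) \<Otimes>\<^sub>M borel \<rightarrow>\<^sub>M (borel :: ('a \<times> 'b) measure)"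
    unfolding borel_prod[symmetric]
    by (intro measurable_Pair measurable_compose[OF measurable_fst measurable_borel_of_subtopology]
      measurable_snd)
  from measurable_compose[OF this borel_measurable_continuous_onI[OF assms]]
  show ?thesis
    by simp
qed

lemma group_actionI:
  fixes G (structure)
  assumes "group G"
    and closed: "\<And>g x. g \<in> carrier G \<Longrightarrow> x \<in> E \<Longrightarrow> \<alpha> g x \<in> E"
    and one: "\<And>x. x \<in> E \<Longrightarrow> \<alpha> \<one> x = x"
    and mult: "\<And>g h x. g \<in> carrier G \<Longrightarrow> h \<in> carrier G \<Longrightarrow> x \<in> E \<Longrightarrow>
      \<alpha> (g \<otimes> h) x = \<alpha> g (\<alpha> h x)"
  shows "group_action G E (\<lambda>g. restrict (\<alpha> g) E)"
proof -
  interpret group G by fact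
  have bij: "restrict (\<alpha> g) E \<in> Bij E" if g: "g \<in> carrier G" for g
  proof -
    have "bij_betw (\<alpha> g) E E"
      using g by (intro bij_betw_byWitness[where f' = "\<alpha> (inv g)"])
        (auto simp: closed one simp flip: mult)
    then show ?thesis
      by (simp add: Bij_def bij_betw_restrict_eq)
  qed
  moreover have "restrict (\<alpha> (g \<otimes> h)) E
      = restrict (\<alpha> g) E \<otimes>\<^bsub>BijGroup E\<^esub> restrict (\<alpha> h) E"
    if "g \<in> carrier G" "h \<in> carrier G" for g h
    using that bij by (auto simp: BijGroup_def compose_def mult closed intro!: restrict_ext)
  ultimately have "(\<lambda>g. restrict (\<alpha> g) E) \<in> hom G (BijGroup E)"
    by (intro homI) (auto simp: BijGroup_def)
  then show ?thesis
    unfolding group_action_def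
    by (intro group_hom.intro group_BijGroup is_group group_hom_axioms.intro)
qed

lemma measurable_group_action_obs:
  "measurable_group_action (G_normal :: 'n::{finite,wellorder} matrix_vector monoid) top_normal
    borel \<alpha>_obs"
proof -
  interpret topological_group "G_normal :: 'n matrix_vector monoid" top_normal
    by (rule topological_group_G_normal)
  interpret group_action "G_normal :: 'n matrix_vector monoid" "space (borel :: (real ^ 'n::{finite,wellorder}) measure)"
      "\<lambda>g. restrict (\<alpha>_obs g) (space borel)"
    by (rule group_actionI[OF group_G_normal])
      (auto simp: \<alpha>_obs_def matrix_vector_mul_assoc matrix_vector_right_distrib)
  have "continuous_on UNIV (\<lambda>(g :: 'n matrix_vector, x). \<alpha>_obs g x)"
    unfolding \<alpha>_obs_def case_prod_beta by (intro continuous_intros)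
  then have "(\<lambda>(g :: 'n matrix_vector, x). \<alpha>_obs g x) \<in> borel_of top_normal \<Otimes>\<^sub>M borel \<rightarrow>\<^sub>M borel"
    unfolding top_normal_def by (rule measurable_continuous_action)
  then show ?thesis
    by unfold_locales
qed

lemma space_\<Theta>_normal: "space \<Theta>_normal = carrier G_normal"
  by (simp add: \<Theta>_normal_def G_normal_def space_restrict_space)

text \<open>The parameter space is the group itself, on which the group acts by left multiplication.\<close>

lemma \<alpha>_param_eq_mult: "\<alpha>_param g \<theta> = g \<otimes>\<^bsub>G_normal\<^esub> \<theta>"
  by (simp add: \<alpha>_param_def G_normal_def case_prod_beta)

lemma measurable_group_action_param:
  "measurable_group_action (G_normal :: 'n::{finite,wellorder} matrix_vector monoid) top_normal
    \<Theta>_normal \<alpha>_param"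
proof -
  let ?G = "G_normal :: 'n matrix_vector monoid"
  interpret topological_group ?G top_normal
    by (rule topological_group_G_normal)
  interpret group_action ?G "space \<Theta>_normal" "\<lambda>g. restrict (\<alpha>_param g) (space \<Theta>_normal)"
    by (rule group_actionI[OF group_G_normal])
      (simp_all add: space_\<Theta>_normal \<alpha>_param_eq_mult m_assoc del: one_G_normal)
  let ?f = "\<lambda>(g :: 'n matrix_vector, \<theta>). \<alpha>_param g \<theta>"
  let ?B = "borel_of (top_normal :: 'n matrix_vector topology)"
  have space_B: "space ?B = carrier ?G"
    by (simp add: space_borel_of top_normal_def)
  have "continuous_on UNIV ?f"
    unfolding \<alpha>_param_def case_prod_beta by (intro continuous_intros)
  then have "?f \<in> ?B \<Otimes>\<^sub>M borel \<rightarrow>\<^sub>M borel"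
    unfolding top_normal_def by (rule measurable_continuous_action)
  moreover have "(\<lambda>x. (fst x, snd x)) \<in> ?B \<Otimes>\<^sub>M \<Theta>_normal \<rightarrow>\<^sub>M ?B \<Otimes>\<^sub>M borel"
    unfolding \<Theta>_normal_def
    by (intro measurable_Pair measurable_fst
      measurable_compose[OF measurable_snd measurable_restrict_space1] measurable_ident_sets[OF refl])
  ultimately have "(\<lambda>x. ?f (fst x, snd x)) \<in> ?B \<Otimes>\<^sub>M \<Theta>_normal \<rightarrow>\<^sub>M borel"
    by (rule measurable_compose[rotated])
  then have "?f \<in> ?B \<Otimes>\<^sub>M \<Theta>_normal \<rightarrow>\<^sub>M borel"
    by (simp only: prod.collapse)
  moreover have "?f \<in> space (?B \<Otimes>\<^sub>M \<Theta>_normal) \<rightarrow> carrier ?G"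
    by (auto simp: space_pair_measure space_B space_\<Theta>_normal \<alpha>_param_eq_mult simp del: mult_G_normal)
  ultimately have "?f \<in> ?B \<Otimes>\<^sub>M \<Theta>_normal \<rightarrow>\<^sub>M \<Theta>_normal"
    unfolding \<Theta>_normal_def G_normal_def by (intro measurable_restrict_space2) simp_all
  then show ?thesis
    by unfold_locales
qed

section \<open>Affine images of normal distributions\<close>

text \<open>It suffices to compare the two measures on boxes. The preimage of a box is the image of a
  translated box under the inverse of \<open>A\<close>, which divides volumes by \<open>\<bar>det A\<bar>\<close>.\<close>

lemma lborel_affine_matrix:
  fixes A :: "real ^ 'n::{finite,wellorder} ^ 'n::{finite,wellorder}"
  assumes A: "invertible A"
  shows "lborel = density (distr lborel borel (\<lambda>x. A *v x + m)) (\<lambda>_. ennreal \<bar>det A\<bar>)"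
proof (rule lborel_eqI)
  fix l u :: "real ^ 'n::{finite,wellorder}" assume le: "\<And>b. b \<in> Basis \<Longrightarrow> l \<bullet> b \<le> u \<bullet> b"
  let ?T = "\<lambda>x. A *v x + m" and ?B = "matrix_inv A"
  have T [measurable]: "?T \<in> borel \<rightarrow>\<^sub>M borel"
    by (intro borel_measurable_continuous_onI continuous_intros)
  have box: "y + m \<in> box l u \<longleftrightarrow> y \<in> box (l - m) (u - m)" for y
    by (auto simp: mem_box inner_simps algebra_simps)
  have vimage: "?T -` box l u = (*v) ?B ` box (l - m) (u - m)"
  proof (intro equalityI subsetI)
    fix x assume "x \<in> ?T -` box l u"
    then have "A *v x \<in> box (l - m) (u - m)"
      by (simp add: box)
    moreover have "x = ?B *v (A *v x)"
      using A by (simp add: matrix_vector_mul_assoc matrix_inv_left_cancel)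
    ultimately show "x \<in> (*v) ?B ` box (l - m) (u - m)"
      by blast
  next
    fix x assume "x \<in> (*v) ?B ` box (l - m) (u - m)"
    then show "x \<in> ?T -` box l u"
      using A by (auto simp: box matrix_vector_mul_assoc matrix_inv_right_cancel)
  qed
  have lm: "?T -` box l u \<in> lmeasurable"
    unfolding vimage by (intro measurable_linear_image lmeasurable_box) simp
  have "measure lebesgue (?T -` box l u) = \<bar>det ?B\<bar> * measure lebesgue (box (l - m) (u - m))"
    unfolding vimage by (subst measure_linear_image) simp_all
  also have "measure lebesgue (box (l - m) (u - m)) = (\<Prod>b\<in>Basis. (u - l) \<bullet> b)"
    using le by (simp add: measure_lborel_box_eq inner_diff_left)
  finally have "\<bar>det A\<bar> * measure lebesgue (?T -` box l u)
      = \<bar>det A * det ?B\<bar> * (\<Prod>b\<in>Basis. (u - l) \<bullet> b)"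
    by (simp add: abs_mult)
  also have "det A * det ?B = 1"
    using A by (simp add: matrix_inv_right_cancel flip: det_mul)
  finally have meas: "\<bar>det A\<bar> * measure lebesgue (?T -` box l u) = (\<Prod>b\<in>Basis. (u - l) \<bullet> b)"
    by simp
  have sets: "?T -` box l u \<in> sets borel"
    using measurable_sets[OF T, of "box l u"] by simp
  have "emeasure (density (distr lborel borel ?T) (\<lambda>_. ennreal \<bar>det A\<bar>)) (box l u)
      = ennreal \<bar>det A\<bar> * emeasure lborel (?T -` box l u)"
    by (simp add: emeasure_density_const emeasure_distr)
  also have "emeasure lborel (?T -` box l u) = ennreal (measure lebesgue (?T -` box l u))"
  proof -
    have "emeasure lebesgue (?T -` box l u) = emeasure lborel (?T -` box l u)"
      using sets by simp
    then show ?thesis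
      using emeasure_eq_measure2[OF lm] by (rule subst)
  qed
  also have "ennreal \<bar>det A\<bar> * ennreal (measure lebesgue (?T -` box l u))
      = ennreal (\<bar>det A\<bar> * measure lebesgue (?T -` box l u))"
    by (rule ennreal_mult[symmetric]) simp_all
  also note meas
  finally show "emeasure (density (distr lborel borel ?T) (\<lambda>_. ennreal \<bar>det A\<bar>)) (box l u)
      = (\<Prod>b\<in>Basis. (u - l) \<bullet> b)" .
qed simp

lemma measurable_mvn_density [measurable]: "mvn_density \<mu> \<Sigma> \<in> borel_measurable borel"
proof -
  have "continuous_on UNIV (mvn_density \<mu> \<Sigma>)"
    unfolding mvn_density_def divide_inverse by (intro continuous_intros)
  then show ?thesis
    by (rule borel_measurable_continuous_onI)
qed

lemma sets_multivariate_normal [simp, measurable_cong]: "sets (multivariate_normal \<mu> \<Sigma>) = sets borel"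
  by (simp add: multivariate_normal_def)

lemma space_multivariate_normal [simp]: "space (multivariate_normal \<mu> \<Sigma>) = UNIV"
  by (simp add: multivariate_normal_def)

text \<open>The Mahalanobis form \<open>(x - \<mu>) \<bullet> (\<Sigma>\<inverse> (x - \<mu>))\<close> is unchanged when \<open>x\<close>, \<open>\<mu>\<close> and \<open>\<Sigma>\<close> are
  transformed together, so the two densities differ only in their normalising constants.\<close>

lemma mvn_density_affine:
  fixes A :: "real ^ 'n ^ 'n"
  assumes A: "invertible A" and \<Sigma>: "invertible \<Sigma>"
  shows "\<bar>det A\<bar> * mvn_density (A *v \<mu> + m) (A ** \<Sigma> ** transpose A) (A *v x + m)
    = mvn_density \<mu> \<Sigma> x"
proof -
  let ?B = "matrix_inv A" and ?v = "x - \<mu>"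
  have "transpose ?B ** transpose A = mat 1"
    using A by (simp add: matrix_inv_right_cancel transpose_mat flip: matrix_transpose_mul)
  then have "transpose A ** transpose ?B = mat 1"
    by (rule matrix_left_right_inverse[THEN iffD1])
  note cancel = this matrix_inv_left_cancel[OF A] matrix_inv_left_cancel[OF \<Sigma>]
  have "matrix_inv (A ** \<Sigma> ** transpose A) = transpose ?B ** matrix_inv \<Sigma> ** ?B"
  proof (rule matrix_inv_eqI)
    have "transpose ?B ** matrix_inv \<Sigma> ** ?B ** (A ** \<Sigma> ** transpose A)
        = transpose ?B ** (matrix_inv \<Sigma> ** ((?B ** A) ** \<Sigma>)) ** transpose A"
      by (simp only: matrix_mul_assoc)
    also have "\<dots> = mat 1"
      using \<open>transpose ?B ** transpose A = mat 1\<close> by (simp add: cancel)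
    finally show "transpose ?B ** matrix_inv \<Sigma> ** ?B ** (A ** \<Sigma> ** transpose A) = mat 1" .
  qed
  moreover have "A *v x + m - (A *v \<mu> + m) = A *v ?v"
    by (simp add: matrix_vector_mult_diff_distrib)
  moreover have "(A *v ?v) \<bullet> ((transpose ?B ** matrix_inv \<Sigma> ** ?B) *v (A *v ?v))
      = ?v \<bullet> (matrix_inv \<Sigma> *v ?v)"
  proof -
    have adjoint: "(A *v w) \<bullet> z = w \<bullet> (transpose A *v z)" for w z
      using dot_lmul_matrix[of w "transpose A" z] by (simp only: vector_transpose_matrix)
    have "(A *v ?v) \<bullet> ((transpose ?B ** matrix_inv \<Sigma> ** ?B) *v (A *v ?v))
        = ?v \<bullet> ((transpose A ** transpose ?B ** matrix_inv \<Sigma> ** (?B ** A)) *v ?v)"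
      by (simp only: adjoint matrix_mul_assoc matrix_vector_mul_assoc)
    then show ?thesis
      by (simp add: cancel)
  qed
  moreover have "sqrt ((2 * pi) ^ CARD('n) * det (A ** \<Sigma> ** transpose A))
      = \<bar>det A\<bar> * sqrt ((2 * pi) ^ CARD('n) * det \<Sigma>)"
  proof -
    have "(2 * pi) ^ CARD('n) * det (A ** \<Sigma> ** transpose A)
        = (det A)\<^sup>2 * ((2 * pi) ^ CARD('n) * det \<Sigma>)"
      by (simp add: det_mul det_transpose power2_eq_square)
    then show ?thesis
      by (simp only: real_sqrt_mult[of "(det A)\<^sup>2"] real_sqrt_abs)
  qed
  ultimately show ?thesis
    using A by (simp add: mvn_density_def invertible_det_nz)
qed

lemma distr_multivariate_normal_affine:
  fixes A :: "real ^ 'n::{finite,wellorder} ^ 'n::{finite,wellorder}"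
  assumes A: "invertible A" and \<Sigma>: "invertible \<Sigma>"
  shows "distr (multivariate_normal \<mu> \<Sigma>) borel (\<lambda>x. A *v x + m)
    = multivariate_normal (A *v \<mu> + m) (A ** \<Sigma> ** transpose A)"
proof -
  let ?T = "\<lambda>x. A *v x + m"
  let ?f = "\<lambda>x. ennreal (mvn_density (A *v \<mu> + m) (A ** \<Sigma> ** transpose A) x)"
  have [measurable]: "?T \<in> borel \<rightarrow>\<^sub>M borel"
    by (intro borel_measurable_continuous_onI continuous_intros)
  have "multivariate_normal \<mu> \<Sigma> = density lborel (\<lambda>x. ennreal \<bar>det A\<bar> * ?f (?T x))"
    unfolding multivariate_normal_def
    by (simp add: mvn_density_affine[OF A \<Sigma>] flip: ennreal_mult')
  then have "distr (multivariate_normal \<mu> \<Sigma>) borel ?T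
      = density (distr lborel borel ?T) (\<lambda>x. ennreal \<bar>det A\<bar> * ?f x)"
    by (subst density_distr) simp_all
  also have "\<dots> = density (density (distr lborel borel ?T) (\<lambda>_. ennreal \<bar>det A\<bar>)) ?f"
    by (subst density_density_eq) simp_all
  also have "\<dots> = multivariate_normal (A *v \<mu> + m) (A ** \<Sigma> ** transpose A)"
    by (simp add: multivariate_normal_def flip: lborel_affine_matrix[OF A])
  finally show ?thesis .
qed

lemma prob_space_multivariate_normal_standard:
  "prob_space (multivariate_normal 0 (mat 1 :: real ^ 'n ^ 'n))"
proof
  have card: "card (Basis :: (real ^ 'n) set) = CARD('n)"
    by simp
  have "mvn_density 0 (mat 1 :: real ^ 'n ^ 'n) x = (\<Prod>b\<in>Basis. std_normal_density (x \<bullet> b))" for x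
  proof -
    have "- (x \<bullet> x) / 2 = (\<Sum>b\<in>Basis. - (x \<bullet> b)\<^sup>2 / 2)"
      by (subst euclidean_inner) (simp add: power2_eq_square sum_negf sum_divide_distrib)
    then have "exp (- (x \<bullet> x) / 2) = (\<Prod>b\<in>Basis. exp (- (x \<bullet> b)\<^sup>2 / 2))"
      by (simp only: exp_sum finite_Basis)
    moreover have "matrix_inv (mat 1 :: real ^ 'n ^ 'n) = mat 1"
      by (rule matrix_inv_eqI) simp
    ultimately show ?thesis
      by (simp add: mvn_density_def std_normal_density_def prod_dividef card real_sqrt_power
        power_mult_distrib real_sqrt_mult del: DIM_cart)
  qed
  then have "emeasure (multivariate_normal 0 (mat 1 :: real ^ 'n ^ 'n)) UNIV
      = (\<integral>\<^sup>+x. (\<Prod>b\<in>(Basis :: (real ^ 'n) set). ennreal (std_normal_density (x \<bullet> b))) \<partial>lborel)"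
    by (simp add: multivariate_normal_def emeasure_density prod_ennreal)
  also have "\<dots> = (\<Prod>b\<in>(Basis :: (real ^ 'n) set). \<integral>\<^sup>+x. ennreal (std_normal_density x) \<partial>lborel)"
    by (subst nn_integral_lborel_prod) simp_all
  also have "(\<integral>\<^sup>+x. ennreal (std_normal_density x) \<partial>lborel) = 1"
    using prob_space.emeasure_space_1[OF prob_space_normal_density[of 1 0]]
    by (simp add: emeasure_density)
  finally show "emeasure (multivariate_normal 0 (mat 1 :: real ^ 'n ^ 'n))
      (space (multivariate_normal 0 (mat 1))) = 1"
    by simp
qed

text \<open>\<open>N(\<mu>, U U\<^sup>T)\<close> is an affine image of the standard normal distribution.\<close>

lemma prob_space_multivariate_normal:
  fixes U :: "real ^ 'n::{finite,wellorder} ^ 'n::{finite,wellorder}"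
  assumes "invertible U"
  shows "prob_space (multivariate_normal \<mu> (U ** transpose U))"
proof -
  interpret prob_space "multivariate_normal 0 (mat 1 :: real ^ 'n::{finite,wellorder} ^ 'n::{finite,wellorder})"
    by (rule prob_space_multivariate_normal_standard)
  have "prob_space (distr (multivariate_normal 0 (mat 1)) borel (\<lambda>x. U *v x + \<mu>))"
    by (intro prob_space_distr) (auto simp: measurable_cong_sets[OF sets_multivariate_normal refl]
      intro!: borel_measurable_continuous_onI continuous_intros)
  moreover have "invertible (mat 1 :: real ^ 'n::{finite,wellorder} ^ 'n::{finite,wellorder})"
    by (simp add: invertible_det_nz)
  ultimately show ?thesis
    using assms by (simp add: distr_multivariate_normal_affine)
qed

section \<open>Invariance of the likelihood\<close>

lemma normal_likelihood_\<alpha>_param: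
  fixes g \<theta> :: "'n::{finite,wellorder} matrix_vector"
  assumes "g \<in> carrier G_normal" "\<theta> \<in> carrier G_normal"
  shows "normal_likelihood (\<alpha>_param g \<theta>) = distr (normal_likelihood \<theta>) borel (\<alpha>_obs g)"
proof -
  obtain V m U \<mu> where [simp]: "g = (V, m)" "\<theta> = (U, \<mu>)"
    by (cases g; cases \<theta>)
  have "invertible V" "invertible U"
    using assms by (auto intro: upper_triangular_pos_invertible)
  moreover from this have "invertible (U ** transpose U)"
    by (simp add: invertible_det_nz det_mul det_transpose)
  ultimately show ?thesis
    by (simp add: normal_likelihood_def \<alpha>_param_def \<alpha>_obs_def distr_multivariate_normal_affine
      matrix_transpose_mul matrix_mul_assoc)
qed

text \<open>For the invertible transformation \<open>f = \<alpha>_obs g\<close> the push-forward \<open>distr M borel f\<close> evaluated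
  at \<open>f ` A\<close> is \<open>M\<close> evaluated at \<open>f -` f ` A = A\<close>; the set \<open>f ` A\<close> is Borel as the preimage of
  \<open>A\<close> under the action of the inverse of \<open>g\<close>.\<close>

lemma emeasure_normal_likelihood_invariant:
  fixes g \<theta> :: "'n::{finite,wellorder} matrix_vector"
  assumes g: "g \<in> carrier G_normal" and \<theta>: "\<theta> \<in> carrier G_normal" and A: "A \<in> sets borel"
  shows "emeasure (normal_likelihood \<theta>) A
    = emeasure (normal_likelihood (\<alpha>_param g \<theta>)) (\<alpha>_obs g ` A)"
proof -
  let ?h = "inv\<^bsub>G_normal\<^esub> g"
  interpret group "G_normal :: 'n matrix_vector monoid"
    by (rule group_G_normal)
  have comp: "\<alpha>_obs (a \<otimes>\<^bsub>G_normal\<^esub> b) y = \<alpha>_obs a (\<alpha>_obs b y)" for a b :: "'n matrix_vector" and y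
    by (cases a; cases b) (simp add: \<alpha>_obs_def matrix_vector_mul_assoc matrix_vector_right_distrib)
  have one: "\<alpha>_obs \<one>\<^bsub>G_normal\<^esub> y = y" for y :: "real ^ 'n::{finite,wellorder}"
    by (simp add: \<alpha>_obs_def)
  have hg: "\<alpha>_obs ?h (\<alpha>_obs g y) = y" and gh: "\<alpha>_obs g (\<alpha>_obs ?h y) = y" for y
    using g one by (simp_all del: one_G_normal flip: comp)
  have meas [measurable]: "\<alpha>_obs a \<in> borel \<rightarrow>\<^sub>M borel" for a :: "'n matrix_vector"
    unfolding \<alpha>_obs_def case_prod_beta by (intro borel_measurable_continuous_onI continuous_intros)
  have image: "\<alpha>_obs g ` A = \<alpha>_obs ?h -` A"
    using hg gh by (auto simp: image_iff) metis
  have "\<alpha>_obs ?h -` A \<in> sets borel"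
    using measurable_sets[OF meas A, of ?h] by simp
  moreover have "\<alpha>_obs g -` \<alpha>_obs ?h -` A = A"
    by (auto simp: hg)
  moreover have "sets (normal_likelihood \<theta>) = sets borel" "space (normal_likelihood \<theta>) = UNIV"
    by (simp_all add: normal_likelihood_def case_prod_beta)
  moreover from this have "\<alpha>_obs g \<in> normal_likelihood \<theta> \<rightarrow>\<^sub>M borel"
    using meas by (simp cong: measurable_cong_sets)
  ultimately show ?thesis
    by (simp add: normal_likelihood_\<alpha>_param[OF g \<theta>] image emeasure_distr)
qed

theorem proposition1p2:
  shows "locally_compact_group_likelihood
    (G_normal :: 'n::{finite,wellorder} matrix_vector monoid) top_normal
    borel \<Theta>_normal normal_likelihood \<alpha>_obs \<alpha>_param"
proof -
  interpret locally_compact_group "G_normal :: 'n matrix_vector monoid" top_normal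
    by (rule locally_compact_group_G_normal)
  show ?thesis
  proof (intro locally_compact_group_likelihood.intro locally_compact_group_axioms
      measurable_group_action_obs measurable_group_action_param
      locally_compact_group_likelihood_axioms.intro standard_borel_borel)
    fix \<theta> :: "'n matrix_vector" assume "\<theta> \<in> space \<Theta>_normal"
    then have \<theta>: "\<theta> \<in> carrier G_normal"
      by (simp add: space_\<Theta>_normal)
    then show "prob_space (normal_likelihood \<theta>)"
      by (cases \<theta>) (simp add: normal_likelihood_def prob_space_multivariate_normal
        upper_triangular_pos_invertible)
    show "sets (normal_likelihood \<theta>) = sets borel"
      by (simp add: normal_likelihood_def case_prod_beta)
    fix g :: "'n matrix_vector" and A :: "(real ^ 'n::{finite,wellorder}) set"
    assume "g \<in> carrier G_normal" "A \<in> sets borel"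
    with \<theta> show "emeasure (normal_likelihood \<theta>) A
        = emeasure (normal_likelihood (\<alpha>_param g \<theta>)) (\<alpha>_obs g ` A)"
      by (intro emeasure_normal_likelihood_invariant)
  qed
qed

end
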